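(* Let $n\geq 1$, $Q=2n+2$, and fix a point $p_0=(x_0,y_0,t_0)\in\mathbb H^n$. Consider the horizontal vector field $$\zeta(p)=\sum_{i=1}^n\big((x_i-x_{0,i})X_i+(y_i-y_{0,i})X_{n+i}\big)$$ and the function $$f(p)=2(t-t_0)+\langle x,y_0\rangle-\langle x_0,y\rangle,\qquad p=(x,y,t)\in\mathbb H^n .$$ Then on any $C^2$ oriented non-characteristic hypersurface $\mathcal S\subset\mathbb H^n$ (or on any $C^2$ oriented hypersurface $\mathcal S$, but away from its characteristic set $\Sigma_{\mathcal S}$) one has the identity $$div_{H,\mathcal S}\,\zeta+\langle\boldsymbol c^{H,\mathcal S},\zeta\rangle+(T-\overline\omega\,Y)f\ \equiv\ Q-1 .$$
   Context: The Heisenberg group $\mathbb H^n$ is $\mathbb R^{2n+1}$ with points $p=(x,y,t)$, $x,y\in\mathbb R^n$, $t\in\mathbb R$, and group law $(x,y,t)\cdot(x',y',t')=(x+x',y+y',t+t'+\frac12(\langle x,y'\rangle-\langle x',y\rangle))$. For $i=1,\dots,n$ let $X_i=\partial_{x_i}-\frac{y_i}2\partial_t$, $X_{n+i}=\partial_{y_i}+\frac{x_i}2\partial_t$, $T=\partial_t$. $\mathbb H^n$ carries the left-invariant Riemannian metric $\langle\cdot,\cdot\rangle$ making $X_1,\dots,X_{2n},T$ orthonormal. The horizontal bundle is $H\mathbb H^n=\mathrm{span}\{X_1,\dots,X_{2n}\}$. For a $C^1$ function $F$, $\nabla F=\sum_{j=1}^{2n}(X_jF)X_j+(TF)T$ and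 $\nabla^HF=\sum_{j=1}^{2n}(X_jF)X_j$. Let $\mathcal S\subset\mathbb H^n$ be a $C^2$ oriented hypersurface with Riemannian unit normal $\boldsymbol\nu$. Put $\boldsymbol N^H=\sum_{j=1}^{2n}\langle\boldsymbol\nu,X_j\rangle X_j$ and $W=|\boldsymbol N^H|$. The characteristic set is $\Sigma_{\mathcal S}=\{p\in\mathcal S: W(p)=0\}$; $\mathcal S$ is non-characteristic if $\Sigma_{\mathcal S}=\varnothing$. On $\mathcal S\setminus\Sigma_{\mathcal S}$ set $\boldsymbol\nu^H=\boldsymbol N^H/W$, $\overline p_i=\langle\boldsymbol\nu^H,X_i\rangle$, $\overline q_i=\langle\boldsymbol\nu^H,X_{n+i}\rangle$ ($i=1,\dots,n$), $\overline\omega=\langle\boldsymbol\nu,T\rangle/W$, and $$\boldsymbol c^{H,\mathcal S}=\overline\omega\,(\boldsymbol\nu^H)^\perp,\qquad (\boldsymbol\nu^H)^\perp=\sum_{i=1}^n\big(\overline q_iX_i-\overline p_iX_{n+i}\big).$$ For $u\in C^1(\mathcal S)$ with $C^1$ extension $\overline u$, the tangential horizontal gradient is $\nabla^{H,\mathcal S}u=\nabla^H\overline u-\langle\nabla^H\overline u,\boldsymbol\nu^H\rangle\boldsymbol\nu^H=\sum_{i=1}^{2n}(\nabla_i^{H,\mathcal S}u)X_i$. For a horizontal field $\zeta=\sum_{i=1}^{2n}\zeta_iX_i$, $div_{H,\mathcal S}\,\zeta=\sum_{i=1}^{2n}\nabla^{H,\mathcal S}_i\zeta_i$. Finally $Yf=\langle\nabla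 f,\boldsymbol\nu^H\rangle$. *)

theory Defs
  imports "HOL-Analysis.Analysis"
begin

section \<open>The Heisenberg group\<close>

text \<open>Points are triples \<open>(x, y, t)\<close> and the dimension \<open>n\<close> is \<open>CARD('n)\<close>. Tangent
  vectors at any point are given by their Euclidean coordinates, so they have the same type.\<close>

type_synonym 'n heis = "(real ^ 'n) \<times> (real ^ 'n) \<times> real"

definition heis_mult :: "'n::finite heis \<Rightarrow> 'n heis \<Rightarrow> 'n heis" where
  "heis_mult = (\<lambda>(x, y, t) (x', y', t'). (x + x', y + y', t + t' + (x \<bullet> y' - x' \<bullet> y) / 2))"

text \<open>The horizontal fields are indexed by \<open>'n + 'n\<close>: \<open>X (Inl i)\<close> is $X_i$ and
  \<open>X (Inr i)\<close> is $X_{n+i}$.\<close>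

fun X :: "'n::finite + 'n \<Rightarrow> 'n heis \<Rightarrow> 'n heis" where
  "X (Inl i) (x, y, t) = (axis i 1, 0, - (y $ i) / 2)"
| "X (Inr i) (x, y, t) = (0, axis i 1, (x $ i) / 2)"

definition T :: "'n::finite heis \<Rightarrow> 'n heis" where
  "T p = (0, 0, 1)"

text \<open>The tangent vector \<open>(a, b, c)\<close> at \<open>(x, y, t)\<close> has coefficients \<open>a\<close>, \<open>b\<close> and
  \<open>vert (x, y, t) (a, b, c)\<close> in the frame formed by the $X_i$, the $X_{n+i}$ and $T$.
  The lemmas below confirm that \<open>hmetric\<close> is the left-invariant Riemannian metric for which
  this frame is orthonormal.\<close>

definition vert :: "'n::finite heis \<Rightarrow> 'n heis \<Rightarrow> real" where
  "vert = (\<lambda>(x, y, t) (a, b, c). c + (y \<bullet> a - x \<bullet> b) / 2)"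

definition hmetric :: "'n::finite heis \<Rightarrow> 'n heis \<Rightarrow> 'n heis \<Rightarrow> real" where
  "hmetric p v w =
     fst v \<bullet> fst w + fst (snd v) \<bullet> fst (snd w) + vert p v * vert p w"

lemma hmetric_X_X: "hmetric p (X j p) (X k p) = (if j = k then 1 else 0)"
  by (cases p; cases j; cases k)
     (auto simp: hmetric_def vert_def inner_axis inner_axis_axis axis_nth axis_eq_axis, auto simp: axis_def)

lemma hmetric_X_T: "hmetric p (X j p) (T p) = 0"
  by (cases p; cases j) (auto simp: hmetric_def vert_def T_def inner_axis)

lemma hmetric_T_T: "hmetric p (T p) (T p) = 1"
  by (cases p) (auto simp: hmetric_def vert_def T_def)

lemma hmetric_sym: "hmetric p v w = hmetric p w v"
  by (simp add: hmetric_def inner_commute)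

lemma linear_hmetric: "linear (hmetric p v)"
  by (cases p; cases v)
     (auto intro!: linearI simp: hmetric_def vert_def inner_simps algebra_simps add_divide_distrib diff_divide_distrib)

lemma hmetric_eq_0_iff: "hmetric p v v = 0 \<longleftrightarrow> v = 0"
proof -
  have "hmetric p v v = 0 \<longleftrightarrow> fst v = 0 \<and> fst (snd v) = 0 \<and> vert p v = 0"
    by (simp add: hmetric_def add_nonneg_eq_0_iff conj_assoc)
  then show ?thesis
    by (cases p; cases v) (auto simp: vert_def zero_prod_def)
qed

lemma heis_mult_has_derivative:
  "(heis_mult (x, y, t) has_derivative (\<lambda>(a, b, c). (a, b, c + (x \<bullet> b - a \<bullet> y) / 2))) (at q)"
  unfolding heis_mult_def case_prod_unfold
  by (auto intro!: derivative_eq_intros)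

lemma hmetric_left_invariant:
  assumes "(heis_mult p has_derivative D) (at q)"
  shows "hmetric (heis_mult p q) (D v) (D w) = hmetric q v w"
proof (cases p)
  case (fields x y t)
  have "D = (\<lambda>(a, b, c). (a, b, c + (x \<bullet> b - a \<bullet> y) / 2))"
    using assms heis_mult_has_derivative has_derivative_unique fields by blast
  then show ?thesis
    by (cases q; cases v; cases w)
       (auto simp: fields heis_mult_def hmetric_def vert_def inner_simps inner_commute field_simps)
qed


section \<open>Derivatives and gradients\<close>

definition C1_on :: "('a::real_normed_vector \<Rightarrow> 'b::real_normed_vector) \<Rightarrow> 'a set \<Rightarrow> bool" where
  "C1_on F U \<longleftrightarrow>
     (\<exists>F' :: 'a \<Rightarrow> 'a \<Rightarrow>\<^sub>L 'b.
        (\<forall>p\<in>U. (F has_derivative blinfun_apply (F' p)) (at p)) \<and> continuous_on U F')"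

definition C2_on :: "('a::real_normed_vector \<Rightarrow> 'b::real_normed_vector) \<Rightarrow> 'a set \<Rightarrow> bool" where
  "C2_on F U \<longleftrightarrow>
     (\<exists>F' :: 'a \<Rightarrow> 'a \<Rightarrow>\<^sub>L 'b.
        (\<forall>p\<in>U. (F has_derivative blinfun_apply (F' p)) (at p)) \<and> C1_on F' U)"

definition deriv_along :: "('n::finite heis \<Rightarrow> 'n heis) \<Rightarrow> ('n heis \<Rightarrow> real) \<Rightarrow> 'n heis \<Rightarrow> real" where
  "deriv_along V F p = frechet_derivative F (at p) (V p)"

definition hgrad :: "('n::finite heis \<Rightarrow> real) \<Rightarrow> 'n heis \<Rightarrow> 'n heis" where
  "hgrad F p = (\<Sum>j\<in>UNIV. deriv_along (X j) F p *\<^sub>R X j p)"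

definition grad :: "('n::finite heis \<Rightarrow> real) \<Rightarrow> 'n heis \<Rightarrow> 'n heis" where
  "grad F p = (\<Sum>j\<in>UNIV. deriv_along (X j) F p *\<^sub>R X j p) + deriv_along T F p *\<^sub>R T p"


section \<open>Oriented hypersurfaces\<close>

text \<open>\<open>\<phi>\<close> is a \<open>C\<^sup>2\<close> defining function of \<open>S\<close> on the open neighbourhood \<open>U\<close> of \<open>p\<close>.\<close>

definition defining_function ::
  "'n::finite heis set \<Rightarrow> 'n heis \<Rightarrow> 'n heis set \<Rightarrow> ('n heis \<Rightarrow> real) \<Rightarrow> bool" where
  "defining_function S p U \<phi> \<longleftrightarrow>
     open U \<and> p \<in> U \<and> C2_on \<phi> U \<and>
     (\<forall>q\<in>U. grad \<phi> q \<noteq> 0) \<and> S \<inter> U = {q \<in> U. \<phi> q = 0}"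

definition C2_hypersurface :: "'n::finite heis set \<Rightarrow> bool" where
  "C2_hypersurface S \<longleftrightarrow> (\<forall>p\<in>S. \<exists>U \<phi>. defining_function S p U \<phi>)"

text \<open>On a hypersurface the kernel does not depend on the defining function.\<close>

definition tangent_space :: "'n::finite heis set \<Rightarrow> 'n heis \<Rightarrow> 'n heis set" where
  "tangent_space S p =
     {v. \<exists>U \<phi>. defining_function S p U \<phi> \<and> frechet_derivative \<phi> (at p) v = 0}"

text \<open>An orientation is a choice of continuous Riemannian unit normal \<open>\<nu>\<close> along \<open>S\<close>.\<close>

definition unit_normal :: "'n::finite heis set \<Rightarrow> ('n heis \<Rightarrow> 'n heis) \<Rightarrow> bool" where
  "unit_normal S \<nu> \<longleftrightarrow>
     continuous_on S \<nu> \<and>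
     (\<forall>p\<in>S. hmetric p (\<nu> p) (\<nu> p) = 1 \<and> (\<forall>v\<in>tangent_space S p. hmetric p (\<nu> p) v = 0))"

definition oriented_C2_hypersurface ::
  "'n::finite heis set \<Rightarrow> ('n heis \<Rightarrow> 'n heis) \<Rightarrow> bool" where
  "oriented_C2_hypersurface S \<nu> \<longleftrightarrow> C2_hypersurface S \<and> unit_normal S \<nu>"


section \<open>Horizontal geometry of an oriented hypersurface\<close>

definition NH :: "('n::finite heis \<Rightarrow> 'n heis) \<Rightarrow> 'n heis \<Rightarrow> 'n heis" where
  "NH \<nu> p = (\<Sum>j\<in>UNIV. hmetric p (\<nu> p) (X j p) *\<^sub>R X j p)"

definition W :: "('n::finite heis \<Rightarrow> 'n heis) \<Rightarrow> 'n heis \<Rightarrow> real" where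
  "W \<nu> p = sqrt (hmetric p (NH \<nu> p) (NH \<nu> p))"

definition char_set :: "'n::finite heis set \<Rightarrow> ('n heis \<Rightarrow> 'n heis) \<Rightarrow> 'n heis set" where
  "char_set S \<nu> = {p \<in> S. W \<nu> p = 0}"

definition non_characteristic :: "'n::finite heis set \<Rightarrow> ('n heis \<Rightarrow> 'n heis) \<Rightarrow> bool" where
  "non_characteristic S \<nu> \<longleftrightarrow> char_set S \<nu> = {}"

text \<open>The following quantities are meaningful only off the characteristic set.\<close>

definition nuH :: "('n::finite heis \<Rightarrow> 'n heis) \<Rightarrow> 'n heis \<Rightarrow> 'n heis" where
  "nuH \<nu> p = (1 / W \<nu> p) *\<^sub>R NH \<nu> p"

definition pbar :: "('n::finite heis \<Rightarrow> 'n heis) \<Rightarrow> 'n \<Rightarrow> 'n heis \<Rightarrow> real" where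
  "pbar \<nu> i p = hmetric p (nuH \<nu> p) (X (Inl i) p)"

definition qbar :: "('n::finite heis \<Rightarrow> 'n heis) \<Rightarrow> 'n \<Rightarrow> 'n heis \<Rightarrow> real" where
  "qbar \<nu> i p = hmetric p (nuH \<nu> p) (X (Inr i) p)"

definition omegabar :: "('n::finite heis \<Rightarrow> 'n heis) \<Rightarrow> 'n heis \<Rightarrow> real" where
  "omegabar \<nu> p = hmetric p (\<nu> p) (T p) / W \<nu> p"

definition nuH_perp :: "('n::finite heis \<Rightarrow> 'n heis) \<Rightarrow> 'n heis \<Rightarrow> 'n heis" where
  "nuH_perp \<nu> p = (\<Sum>i\<in>UNIV. qbar \<nu> i p *\<^sub>R X (Inl i) p - pbar \<nu> i p *\<^sub>R X (Inr i) p)"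

definition cHS :: "('n::finite heis \<Rightarrow> 'n heis) \<Rightarrow> 'n heis \<Rightarrow> 'n heis" where
  "cHS \<nu> p = omegabar \<nu> p *\<^sub>R nuH_perp \<nu> p"

definition C1_extension ::
  "'n::finite heis set \<Rightarrow> ('n heis \<Rightarrow> real) \<Rightarrow> ('n heis \<Rightarrow> real) \<Rightarrow> bool" where
  "C1_extension S u ubar \<longleftrightarrow>
     (\<exists>U. open U \<and> S \<subseteq> U \<and> C1_on ubar U) \<and> (\<forall>p\<in>S. ubar p = u p)"

text \<open>Only the values of \<open>u\<close> on \<open>S\<close> enter. Off the characteristic set the result does not
  depend on the extension: two extensions differ by a function vanishing on \<open>S\<close>, whose
  horizontal gradient at points of \<open>S\<close> is a multiple of \<open>NH \<nu>\<close>.\<close>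

definition tangential_hgrad ::
  "'n::finite heis set \<Rightarrow> ('n heis \<Rightarrow> 'n heis) \<Rightarrow> ('n heis \<Rightarrow> real) \<Rightarrow> 'n heis \<Rightarrow> 'n heis" where
  "tangential_hgrad S \<nu> u p =
     (let ubar = (SOME ubar. C1_extension S u ubar)
      in hgrad ubar p - hmetric p (hgrad ubar p) (nuH \<nu> p) *\<^sub>R nuH \<nu> p)"

text \<open>For a horizontal field \<open>\<zeta>\<close> the $j$-th component is its inner product with \<open>X j\<close>;
  likewise for the tangential horizontal gradient.\<close>

definition div_HS ::
  "'n::finite heis set \<Rightarrow> ('n heis \<Rightarrow> 'n heis) \<Rightarrow> ('n heis \<Rightarrow> 'n heis) \<Rightarrow> 'n heis \<Rightarrow> real" where
  "div_HS S \<nu> \<zeta> p =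
     (\<Sum>j\<in>UNIV. hmetric p (tangential_hgrad S \<nu> (\<lambda>q. hmetric q (\<zeta> q) (X j q)) p) (X j p))"

definition Y :: "('n::finite heis \<Rightarrow> 'n heis) \<Rightarrow> ('n heis \<Rightarrow> real) \<Rightarrow> 'n heis \<Rightarrow> real" where
  "Y \<nu> F p = hmetric p (grad F p) (nuH \<nu> p)"

end

theory Submission
  imports Defs
begin

text \<open>
  The functions in question are affine, and in the frame \<open>X j\<close> everything is explicit. The
  component functions of \<open>\<zeta>\<close> are the coordinates \<open>u j\<close> centred at the base point, and the
  horizontal gradient of \<open>u j\<close> is \<open>X j\<close>. Removing the part along the unit vector \<open>nuH\<close>, with
  components \<open>n j\<close>, leaves \<open>1 - (n j)\<^sup>2\<close> as the \<open>j\<close>-th component, so the divergence is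
  \<open>2 * CARD('n) - 1\<close>. The function \<open>f\<close> is chosen so that \<open>T f = 2\<close> and so that its horizontal
  gradient is \<open>\<zeta>\<close> rotated by a right angle; since \<open>nuH_perp\<close> is \<open>nuH\<close> rotated in the opposite
  sense, \<open>omegabar * Y f\<close> cancels the inner product of \<open>cHS\<close> and \<open>\<zeta>\<close>. What remains is
  \<open>2 * CARD('n) + 1\<close>.

  The substantial point is that the divergence may be computed with the obvious
  extensions of the components of \<open>\<zeta>\<close>, although \<open>tangential_hgrad\<close> picks an arbitrary one. The
  difference of two extensions vanishes on the hypersurface, so its derivative vanishes on tangent
  vectors (\<open>derivative_zero_on_kernel\<close>) and is a multiple of the inner product with the
  normal (\<open>derivative_proportional_normal\<close>). Hence the two horizontal gradients differ by a
  multiple of \<open>NH\<close>, which the projection orthogonal to \<open>nuH\<close> annihilates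
  (\<open>tangential_hgrad_component\<close>).
\<close>

section \<open>Functions vanishing on a level set\<close>

text \<open>Moving from \<open>p\<close> along \<open>v\<close> and correcting in the
  direction \<open>w\<close>, the intermediate value theorem finds a zero of \<open>\<phi>\<close> at \<open>p + s *\<^sub>R (v + r *\<^sub>R w)\<close>
  with \<open>r\<close> as small as desired. There \<open>h\<close> vanishes too, which bounds \<open>h' v\<close> by
  a multiple of \<open>\<bar>r\<bar>\<close> up to the error of the linear approximation of \<open>h\<close>.\<close>

lemma derivative_zero_on_kernel:
  fixes \<phi> h :: "'a::real_normed_vector \<Rightarrow> real"
  assumes U: "open U" "p \<in> U"
    and cont: "continuous_on U \<phi>"
    and \<phi>: "(\<phi> has_derivative \<phi>') (at p)" and h: "(h has_derivative h') (at p)"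
    and zero: "\<And>q. q \<in> U \<Longrightarrow> \<phi> q = 0 \<Longrightarrow> h q = 0"
    and p0: "\<phi> p = 0" and v: "\<phi>' v = 0" and w: "\<phi>' w = 1"
  shows "h' v = 0"
proof (rule ccontr)
  assume nz: "h' v \<noteq> 0"
  interpret P: bounded_linear \<phi>' using \<phi> by (rule has_derivative_bounded_linear)
  interpret H: bounded_linear h' using h by (rule has_derivative_bounded_linear)
  \<comment> \<open>\<open>\<epsilon>\<close> bounds \<open>\<bar>r\<bar>\<close>: it makes the contribution \<open>r * h' w\<close> at most half of \<open>\<bar>h' v\<bar>\<close>. The other half
    absorbs the linearization error of \<open>h\<close>, which is why \<open>\<eta>\<close> below depends on \<open>\<bar>h' v\<bar>\<close>.\<close>
  define \<epsilon> where "\<epsilon> = min 1 (\<bar>h' v\<bar> / (2 * (\<bar>h' w\<bar> + 1)))"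
  have \<epsilon>: "0 < \<epsilon>" "\<epsilon> \<le> 1" "\<epsilon> * (\<bar>h' w\<bar> + 1) \<le> \<bar>h' v\<bar> / 2"
  proof -
    show "0 < \<epsilon>" "\<epsilon> \<le> 1" using nz by (auto simp: \<epsilon>_def)
    have "\<epsilon> * (\<bar>h' w\<bar> + 1) \<le> \<bar>h' v\<bar> / (2 * (\<bar>h' w\<bar> + 1)) * (\<bar>h' w\<bar> + 1)"
      by (intro mult_right_mono) (auto simp: \<epsilon>_def)
    also have "\<dots> = \<bar>h' v\<bar> / 2"
      by (simp add: field_simps)
    finally show "\<epsilon> * (\<bar>h' w\<bar> + 1) \<le> \<bar>h' v\<bar> / 2" .
  qed
  define M where "M = norm v + norm w + 1"
  have M: "0 < M" by (simp add: M_def add_nonneg_pos)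
  define \<eta> where "\<eta> = min (\<epsilon> / 2) (\<bar>h' v\<bar> / 4) / M"
  have \<eta>: "0 < \<eta>" "\<eta> * M < \<epsilon>" "\<eta> * M < \<bar>h' v\<bar> / 2"
    using M \<epsilon>(1) nz by (auto simp: \<eta>_def min_def)
  obtain d1 where d1: "d1 > 0"
    "\<And>q. norm (q - p) < d1 \<Longrightarrow> norm (\<phi> q - \<phi> p - \<phi>' (q - p)) \<le> \<eta> * norm (q - p)"
    using \<phi> \<eta>(1) unfolding has_derivative_at_alt by blast
  obtain d2 where d2: "d2 > 0"
    "\<And>q. norm (q - p) < d2 \<Longrightarrow> norm (h q - h p - h' (q - p)) \<le> \<eta> * norm (q - p)"
    using h \<eta>(1) unfolding has_derivative_at_alt by blast
  obtain d3 where d3: "d3 > 0" "ball p d3 \<subseteq> U"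
    using U open_contains_ball by blast
  define s where "s = min d1 (min d2 d3) / (2 * M)"
  have s: "0 < s" "s * M < d1" "s * M < d2" "s * M < d3"
    using M d1(1) d2(1) d3(1) by (auto simp: s_def min_def)
  define g where "g r = p + s *\<^sub>R (v + r *\<^sub>R w)" for r
  have g_diff: "g r - p = s *\<^sub>R (v + r *\<^sub>R w)" for r
    by (simp add: g_def)
  have gn: "norm (g r - p) \<le> s * M" if "\<bar>r\<bar> \<le> \<epsilon>" for r
  proof -
    have "\<bar>r\<bar> * norm w \<le> 1 * norm w"
      using that \<epsilon>(2) by (intro mult_right_mono) auto
    then have "norm (v + r *\<^sub>R w) \<le> M"
      using norm_triangle_ineq[of v "r *\<^sub>R w"] by (simp add: M_def)
    then show ?thesis
      using s(1) by (simp add: g_diff)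
  qed
  have gU: "g r \<in> U" if "\<bar>r\<bar> \<le> \<epsilon>" for r
    using gn[OF that] s(4) d3(2) by (auto simp: dist_norm norm_minus_commute)
  have err: "\<bar>\<phi> (g r) - s * r\<bar> < s * \<epsilon>" "\<bar>h (g r) - s * (h' v + r * h' w)\<bar> < s * (\<bar>h' v\<bar> / 2)"
    if "\<bar>r\<bar> \<le> \<epsilon>" for r
  proof -
    have le: "\<eta> * norm (g r - p) \<le> s * (\<eta> * M)"
      using mult_left_mono[OF gn[OF that], of \<eta>] \<eta>(1) by (simp add: mult_ac)
    have "\<bar>\<phi> (g r) - s * r\<bar> \<le> \<eta> * norm (g r - p)"
      using d1(2)[of "g r"] gn[OF that] s(2) p0 v w
      by (simp add: g_diff P.scaleR P.add)
    also have "\<dots> < s * \<epsilon>"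
      using le mult_strict_left_mono[OF \<eta>(2) s(1)] by linarith
    finally show "\<bar>\<phi> (g r) - s * r\<bar> < s * \<epsilon>" .
    have "\<bar>h (g r) - s * (h' v + r * h' w)\<bar> \<le> \<eta> * norm (g r - p)"
      using d2(2)[of "g r"] gn[OF that] s(3) zero[OF U(2) p0]
      by (simp add: g_diff H.scaleR H.add)
    also have "\<dots> < s * (\<bar>h' v\<bar> / 2)"
      using le mult_strict_left_mono[OF \<eta>(3) s(1)] by linarith
    finally show "\<bar>h (g r) - s * (h' v + r * h' w)\<bar> < s * (\<bar>h' v\<bar> / 2)" .
  qed
  have "\<exists>r\<ge>-\<epsilon>. r \<le> \<epsilon> \<and> \<phi> (g r) = 0"
  proof (rule IVT')
    show "\<phi> (g (-\<epsilon>)) \<le> 0" using err(1)[of "-\<epsilon>"] \<epsilon>(1) by simp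
    show "0 \<le> \<phi> (g \<epsilon>)" using err(1)[of \<epsilon>] \<epsilon>(1) by simp
    show "- \<epsilon> \<le> \<epsilon>" using \<epsilon>(1) by simp
    show "continuous_on {-\<epsilon>..\<epsilon>} (\<lambda>r. \<phi> (g r))"
    proof (rule continuous_on_compose2[OF cont])
      show "continuous_on {-\<epsilon>..\<epsilon>} g" unfolding g_def by (intro continuous_intros)
      show "g ` {-\<epsilon>..\<epsilon>} \<subseteq> U" using gU by auto
    qed
  qed
  then obtain r where "-\<epsilon> \<le> r" "r \<le> \<epsilon>" and "\<phi> (g r) = 0" by blast
  then have r: "\<bar>r\<bar> \<le> \<epsilon>" "\<phi> (g r) = 0" by auto
  have "h (g r) = 0" using zero gU r by blast
  then have "s * \<bar>h' v + r * h' w\<bar> < s * (\<bar>h' v\<bar> / 2)"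
    using err(2)[OF r(1)] s(1) by (simp add: abs_mult)
  then have *: "\<bar>h' v + r * h' w\<bar> < \<bar>h' v\<bar> / 2" using s(1) by simp
  have "\<bar>r * h' w\<bar> \<le> \<epsilon> * (\<bar>h' w\<bar> + 1)"
    unfolding abs_mult using r(1) \<epsilon>(1) by (intro mult_mono) auto
  then show False using * \<epsilon>(3) by linarith
qed

lemma C1_on_has_derivative:
  assumes "C1_on F U" "p \<in> U"
  shows "(F has_derivative frechet_derivative F (at p)) (at p)"
  using assms unfolding C1_on_def
  by (metis differentiable_def frechet_derivative_works)

lemma C2_on_has_derivative:
  assumes "C2_on F U" "p \<in> U"
  shows "(F has_derivative frechet_derivative F (at p)) (at p)"
  using assms unfolding C2_on_def
  by (metis differentiable_def frechet_derivative_works)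

lemma C1_on_affine:
  assumes "bounded_linear L"
  shows "C1_on (\<lambda>q. L q + c) U"
  unfolding C1_on_def
proof (intro exI[of _ "\<lambda>_. Blinfun L"] conjI ballI)
  fix p
  have "((\<lambda>q. L q + c) has_derivative L) (at p)"
    using bounded_linear_imp_has_derivative[OF assms] by (auto intro!: derivative_eq_intros)
  then show "((\<lambda>q. L q + c) has_derivative blinfun_apply (Blinfun L)) (at p)"
    by (simp add: bounded_linear_Blinfun_apply[OF assms])
qed simp

section \<open>The horizontal frame\<close>

lemma bounded_linear_hmetric: "bounded_linear (hmetric p v)"
  using linear_hmetric linear_conv_bounded_linear by blast

lemma hmetric_frame_sum:
  "hmetric p (\<Sum>j\<in>UNIV. c j *\<^sub>R X j p) v = (\<Sum>j\<in>UNIV. c j * hmetric p (X j p) v)"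
  by (simp add: hmetric_sym[of p _ v] linear_sum[OF linear_hmetric] linear_cmul[OF linear_hmetric])

lemma hmetric_frame_sum_X:
  "hmetric p (\<Sum>j\<in>UNIV. c j *\<^sub>R X j p) (X k p) = c k"
  by (simp add: hmetric_frame_sum hmetric_X_X if_distrib cong: if_cong)

lemma hmetric_frame_sum_frame_sum:
  "hmetric p (\<Sum>j\<in>UNIV. c j *\<^sub>R X j p) (\<Sum>j\<in>UNIV. d j *\<^sub>R X j p) = (\<Sum>j\<in>UNIV. c j * d j)"
  unfolding hmetric_frame_sum[of p c]
  by (simp add: hmetric_sym[of p "X _ p"] hmetric_frame_sum_X)

lemma sum_sum_type:
  "(\<Sum>j\<in>UNIV. g j) = (\<Sum>i\<in>UNIV. g (Inl i)) + (\<Sum>i\<in>UNIV. g (Inr i))"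
  for g :: "'a::finite + 'b::finite \<Rightarrow> 'c::comm_monoid_add"
  by (simp add: UNIV_Plus_UNIV[symmetric] sum.Plus del: UNIV_Plus_UNIV)

lemma nuH_frame_sum:
  "nuH \<nu> p = (\<Sum>j\<in>UNIV. hmetric p (nuH \<nu> p) (X j p) *\<^sub>R X j p)"
proof -
  have eq: "nuH \<nu> p = (\<Sum>j\<in>UNIV. (hmetric p (\<nu> p) (X j p) / W \<nu> p) *\<^sub>R X j p)"
    by (simp add: nuH_def NH_def scaleR_sum_right)
  have "hmetric p (nuH \<nu> p) (X j p) = hmetric p (\<nu> p) (X j p) / W \<nu> p" for j
    unfolding eq by (rule hmetric_frame_sum_X)
  with eq show ?thesis by simp
qed

lemma hmetric_nu_X:
  assumes "W \<nu> p \<noteq> 0"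
  shows "hmetric p (\<nu> p) (X j p) = W \<nu> p * hmetric p (nuH \<nu> p) (X j p)"
proof -
  have "hmetric p (nuH \<nu> p) (X j p) = hmetric p (NH \<nu> p) (X j p) / W \<nu> p"
    unfolding nuH_def
    by (simp add: hmetric_sym[of p _ "X j p"] linear_cmul[OF linear_hmetric])
  then show ?thesis
    using assms by (simp add: NH_def hmetric_frame_sum_X)
qed

lemma nuH_unit:
  assumes "W \<nu> p \<noteq> 0"
  shows "(\<Sum>j\<in>UNIV. (hmetric p (nuH \<nu> p) (X j p))\<^sup>2) = 1"
proof -
  have "(W \<nu> p)\<^sup>2 = (\<Sum>j\<in>UNIV. (hmetric p (\<nu> p) (X j p))\<^sup>2)"
    by (simp add: W_def NH_def hmetric_frame_sum_frame_sum sum_nonneg power2_eq_square)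
  also have "\<dots> = (W \<nu> p)\<^sup>2 * (\<Sum>j\<in>UNIV. (hmetric p (nuH \<nu> p) (X j p))\<^sup>2)"
    by (simp add: hmetric_nu_X[OF assms] power_mult_distrib sum_distrib_left)
  finally show ?thesis using assms by simp
qed

section \<open>Independence of the extension\<close>

text \<open>The tangent space is a hyperplane on which both the derivative of \<open>h\<close> and the inner
  product with the normal vanish; the latter is not the zero functional, so the former is a multiple
  of it.\<close>

lemma derivative_proportional_normal:
  assumes S: "oriented_C2_hypersurface S \<nu>" and p: "p \<in> S"
    and h: "(h has_derivative h') (at p)" and zero: "\<And>q. q \<in> S \<Longrightarrow> h q = 0"
  obtains \<mu> where "\<And>v. h' v = \<mu> * hmetric p (\<nu> p) v"
proof -
  obtain U \<phi> where df: "defining_function S p U \<phi>"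
    using S p unfolding oriented_C2_hypersurface_def C2_hypersurface_def by blast
  then have U: "open U" "p \<in> U" and C2: "C2_on \<phi> U" and g: "grad \<phi> p \<noteq> 0"
    and SU: "S \<inter> U = {q \<in> U. \<phi> q = 0}"
    unfolding defining_function_def by auto
  define \<phi>' where "\<phi>' = frechet_derivative \<phi> (at p)"
  have \<phi>: "(\<phi> has_derivative \<phi>') (at p)"
    unfolding \<phi>'_def using C2_on_has_derivative C2 U(2) by blast
  interpret P: bounded_linear \<phi>' using \<phi> by (rule has_derivative_bounded_linear)
  interpret H: bounded_linear h' using h by (rule has_derivative_bounded_linear)
  interpret N: bounded_linear "hmetric p (\<nu> p)" by (rule bounded_linear_hmetric)
  have cont: "continuous_on U \<phi>"
    using C2_on_has_derivative[OF C2] has_derivative_continuous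
    by (blast intro: continuous_at_imp_continuous_on)
  have p0: "\<phi> p = 0" using SU p U(2) by blast
  have "\<exists>w. \<phi>' w \<noteq> 0"
  proof (rule ccontr)
    assume "\<nexists>w. \<phi>' w \<noteq> 0"
    then have "\<phi>' = (\<lambda>_. 0)" by auto
    then have "grad \<phi> p = 0"
      by (simp add: grad_def deriv_along_def \<phi>'_def[symmetric])
    with g show False by contradiction
  qed
  then obtain w' where w': "\<phi>' w' \<noteq> 0" ..
  define w where "w = (1 / \<phi>' w') *\<^sub>R w'"
  have w: "\<phi>' w = 1" using w' by (simp add: w_def P.scaleR)
  have nu: "hmetric p (\<nu> p) (\<nu> p) = 1" "\<And>v. \<phi>' v = 0 \<Longrightarrow> hmetric p (\<nu> p) v = 0"
    using S p df
    unfolding oriented_C2_hypersurface_def unit_normal_def tangent_space_def \<phi>'_def by blast+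
  have hk: "h' v = 0" if "\<phi>' v = 0" for v
    by (rule derivative_zero_on_kernel[OF U cont \<phi> h _ p0 that w]) (use zero SU in blast)
  \<comment> \<open>Every \<open>v\<close> differs from a tangent vector by \<open>\<phi>' v *\<^sub>R w\<close>.\<close>
  have split: "h' v = \<phi>' v * h' w" "hmetric p (\<nu> p) v = \<phi>' v * hmetric p (\<nu> p) w" for v
  proof -
    have k: "\<phi>' (v - \<phi>' v *\<^sub>R w) = 0" by (simp add: P.diff P.scaleR w)
    show "h' v = \<phi>' v * h' w" using hk[OF k] by (simp add: H.diff H.scaleR)
    show "hmetric p (\<nu> p) v = \<phi>' v * hmetric p (\<nu> p) w"
      using nu(2)[OF k] by (simp add: N.diff N.scaleR)
  qed
  have "hmetric p (\<nu> p) w \<noteq> 0" using split(2)[of "\<nu> p"] nu(1) by auto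
  then have "h' v = (h' w / hmetric p (\<nu> p) w) * hmetric p (\<nu> p) v" for v
    using split[of v] by simp
  then show thesis by (rule that)
qed

text \<open>Replacing the chosen extension by \<open>ubar\<close> changes the horizontal gradient by a multiple of
  \<open>nuH\<close>, and \<open>nuH\<close> is a unit vector off the characteristic set, so the projection removes
  the change.\<close>

lemma tangential_hgrad_component:
  assumes S: "oriented_C2_hypersurface S \<nu>" and p: "p \<in> S" and W: "W \<nu> p \<noteq> 0"
    and ext: "C1_extension S u ubar"
  shows "hmetric p (tangential_hgrad S \<nu> u p) (X j p) =
    deriv_along (X j) ubar p
      - (\<Sum>k\<in>UNIV. deriv_along (X k) ubar p * hmetric p (nuH \<nu> p) (X k p))
        * hmetric p (nuH \<nu> p) (X j p)"
proof -
  define vbar where "vbar = (SOME ubar. C1_extension S u ubar)"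
  define n where "n j = hmetric p (nuH \<nu> p) (X j p)" for j
  have ext': "C1_extension S u vbar"
    unfolding vbar_def using ext by (rule someI[where P = "C1_extension S u"])
  have D: "(F has_derivative frechet_derivative F (at p)) (at p)" if "C1_extension S u F" for F
    using that p C1_on_has_derivative unfolding C1_extension_def by blast
  have dh: "((\<lambda>q. vbar q - ubar q) has_derivative
      (\<lambda>v. frechet_derivative vbar (at p) v - frechet_derivative ubar (at p) v)) (at p)"
    by (intro has_derivative_diff D ext ext')
  obtain \<mu> where \<mu>: "\<And>v. frechet_derivative vbar (at p) v - frechet_derivative ubar (at p) v
      = \<mu> * hmetric p (\<nu> p) v"
    by (rule derivative_proportional_normal[OF S p dh])
      (use ext ext' in \<open>auto simp: C1_extension_def\<close>)
  have diff: "deriv_along (X k) vbar p = deriv_along (X k) ubar p + \<mu> * W \<nu> p * n k" for k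
    using \<mu>[of "X k p"] hmetric_nu_X[OF W, of k] by (simp add: deriv_along_def n_def)
  have unit: "(\<Sum>k\<in>UNIV. n k * n k) = 1"
    using nuH_unit[OF W] by (simp add: n_def power2_eq_square)
  have inner: "hmetric p (hgrad vbar p) (nuH \<nu> p) = (\<Sum>k\<in>UNIV. deriv_along (X k) vbar p * n k)"
    by (simp add: hgrad_def hmetric_frame_sum n_def hmetric_sym[of p "nuH \<nu> p"])
  also have "\<dots> = (\<Sum>k\<in>UNIV. deriv_along (X k) ubar p * n k) + \<mu> * W \<nu> p * (\<Sum>k\<in>UNIV. n k * n k)"
    by (simp add: diff distrib_right sum.distrib sum_distrib_left mult.assoc)
  finally have inner': "hmetric p (hgrad vbar p) (nuH \<nu> p) =
      (\<Sum>k\<in>UNIV. deriv_along (X k) ubar p * n k) + \<mu> * W \<nu> p"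
    by (simp add: unit)
  have "hmetric p (tangential_hgrad S \<nu> u p) (X j p) =
      hmetric p (hgrad vbar p) (X j p) - hmetric p (hgrad vbar p) (nuH \<nu> p) * n j"
    unfolding tangential_hgrad_def Let_def vbar_def[symmetric] n_def
    by (simp add: hmetric_sym[of p _ "X j p"] linear_diff[OF linear_hmetric]
        linear_cmul[OF linear_hmetric])
  also have "hmetric p (hgrad vbar p) (X j p) = deriv_along (X j) vbar p"
    by (simp add: hgrad_def hmetric_frame_sum_X)
  finally show ?thesis
    by (simp add: inner' diff n_def algebra_simps)
qed

section \<open>The divergence identity\<close>

definition coord :: "'n::finite + 'n \<Rightarrow> 'n heis \<Rightarrow> real" where
  "coord j p = (case j of Inl i \<Rightarrow> fst p $ i | Inr i \<Rightarrow> fst (snd p) $ i)"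

lemma bounded_linear_coord: "bounded_linear (coord j)"
proof (cases j)
  case (Inl i)
  then have "coord j = (\<lambda>p. fst p $ i)" by (auto simp: coord_def)
  then show ?thesis
    using bounded_linear_compose[OF bounded_linear_vec_nth bounded_linear_fst] by simp
next
  case (Inr i)
  then have "coord j = (\<lambda>p. fst (snd p) $ i)" by (auto simp: coord_def)
  then show ?thesis
    using bounded_linear_compose[OF bounded_linear_vec_nth
        bounded_linear_compose[OF bounded_linear_fst bounded_linear_snd]] by simp
qed

lemma coord_X: "coord j (X k p) = (if j = k then 1 else 0)"
  by (cases p; cases j; cases k) (auto simp: coord_def axis_def)

lemma deriv_along_affine:
  assumes "bounded_linear L"
  shows "deriv_along V (\<lambda>q. L q + c) p = L (V p)"
proof -
  have "((\<lambda>q. L q + c) has_derivative L) (at p)"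
    using bounded_linear_imp_has_derivative[OF assms] by (auto intro!: derivative_eq_intros)
  then show ?thesis
    unfolding deriv_along_def using frechet_derivative_at by metis
qed

text \<open>The \<open>j\<close>-th component of the field has the \<open>j\<close>-th frame vector as horizontal gradient, so the
  divergence is the trace of the orthogonal projection of the horizontal space onto the
  complement of \<open>nuH\<close>.\<close>

lemma div_HS_centred_coordinates:
  fixes S :: "'n::finite heis set"
  assumes S: "oriented_C2_hypersurface S \<nu>" and p: "p \<in> S" and W: "W \<nu> p \<noteq> 0"
  shows "div_HS S \<nu> (\<lambda>q. \<Sum>j\<in>UNIV. (coord j q + a j) *\<^sub>R X j q) p = 2 * real CARD('n) - 1"
proof -
  define n where "n j = hmetric p (nuH \<nu> p) (X j p)" for j
  have "hmetric p (tangential_hgrad S \<nu> (\<lambda>q. coord j q + a j) p) (X j p) = 1 - (n j)\<^sup>2" for j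
  proof -
    have "C1_extension S (\<lambda>q. coord j q + a j) (\<lambda>q. coord j q + a j)"
      unfolding C1_extension_def using C1_on_affine[OF bounded_linear_coord] by blast
    from tangential_hgrad_component[OF S p W this, of j] show ?thesis
      by (simp add: deriv_along_affine[OF bounded_linear_coord] coord_X n_def power2_eq_square
          if_distrib[of "\<lambda>x. x * _"] cong: if_cong)
  qed
  then have "div_HS S \<nu> (\<lambda>q. \<Sum>j\<in>UNIV. (coord j q + a j) *\<^sub>R X j q) p = (\<Sum>j\<in>UNIV. 1 - (n j)\<^sup>2)"
    by (simp add: div_HS_def hmetric_frame_sum_X)
  also have "\<dots> = real CARD('n + 'n) - 1"
    using nuH_unit[OF W] by (simp add: sum_subtractf n_def)
  finally show ?thesis by simp
qed

theorem proposition3p5: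
  fixes S :: "'n::finite heis set"
    and \<nu> \<zeta> :: "'n heis \<Rightarrow> 'n heis"
    and f :: "'n heis \<Rightarrow> real"
    and x0 y0 :: "real ^ 'n" and t0 Q :: real
  assumes Q: "Q = 2 * real CARD('n) + 2"
    and S: "oriented_C2_hypersurface S \<nu>"
    and zeta: "\<zeta> = (\<lambda>(x, y, t). \<Sum>i\<in>UNIV.
        (x $ i - x0 $ i) *\<^sub>R X (Inl i) (x, y, t) + (y $ i - y0 $ i) *\<^sub>R X (Inr i) (x, y, t))"
    and f: "f = (\<lambda>(x, y, t). 2 * (t - t0) + x \<bullet> y0 - x0 \<bullet> y)"
  shows "(\<forall>p \<in> S - char_set S \<nu>.
            div_HS S \<nu> \<zeta> p + hmetric p (cHS \<nu> p) (\<zeta> p)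
              + (deriv_along T f p - omegabar \<nu> p * Y \<nu> f p) = Q - 1) \<and>
         (non_characteristic S \<nu> \<longrightarrow> (\<forall>p \<in> S.
            div_HS S \<nu> \<zeta> p + hmetric p (cHS \<nu> p) (\<zeta> p)
              + (deriv_along T f p - omegabar \<nu> p * Y \<nu> f p) = Q - 1))"
proof -
  define a where "a = case_sum (\<lambda>i. - x0 $ i) (\<lambda>i. - y0 $ i)"
  have \<zeta>: "\<zeta> = (\<lambda>q. \<Sum>j\<in>UNIV. (coord j q + a j) *\<^sub>R X j q)"
    by (auto simp: zeta fun_eq_iff sum_sum_type coord_def a_def sum.distrib[symmetric])
  define L :: "'n heis \<Rightarrow> real" where "L = (\<lambda>(x, y, t). 2 * t + x \<bullet> y0 - x0 \<bullet> y)"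
  have L: "bounded_linear L"
    unfolding linear_conv_bounded_linear[symmetric] L_def
    by (auto intro!: linearI simp: inner_simps algebra_simps)
  define c where "c = - 2 * t0"
  have f_affine: "f = (\<lambda>q. L q + c)"
    by (auto simp: f L_def c_def)
  have id: "div_HS S \<nu> \<zeta> p + hmetric p (cHS \<nu> p) (\<zeta> p)
      + (deriv_along T f p - omegabar \<nu> p * Y \<nu> f p) = Q - 1" if p: "p \<in> S" and W: "W \<nu> p \<noteq> 0" for p
  proof -
    define z where "z j = coord j p + a j" for j
    define n where "n j = hmetric p (nuH \<nu> p) (X j p)" for j
    have Tf: "deriv_along T f p = 2"
      by (simp add: f_affine deriv_along_affine[OF L]) (simp add: L_def T_def)
    have Xl: "deriv_along (X (Inl i)) f p = - z (Inr i)" for i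
      by (cases p) (simp add: f_affine deriv_along_affine[OF L],
          simp add: L_def z_def a_def coord_def inner_axis')
    have Xr: "deriv_along (X (Inr i)) f p = z (Inl i)" for i
      by (cases p) (simp add: f_affine deriv_along_affine[OF L],
          simp add: L_def z_def a_def coord_def inner_axis)
    have T0: "hmetric p (T p) (nuH \<nu> p) = 0"
      by (subst nuH_frame_sum, subst hmetric_sym)
        (simp add: hmetric_frame_sum hmetric_X_T)
    have "Y \<nu> f p = (\<Sum>j\<in>UNIV. deriv_along (X j) f p * n j)"
      unfolding Y_def grad_def n_def
      by (simp add: hmetric_sym[of p _ "nuH \<nu> p"] linear_add[OF linear_hmetric]
          linear_cmul[OF linear_hmetric] linear_sum[OF linear_hmetric] T0[unfolded hmetric_sym[of p "T p"]])
    then have Yf: "Y \<nu> f p = (\<Sum>i\<in>UNIV. z (Inl i) * n (Inr i) - z (Inr i) * n (Inl i))"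
      by (simp add: sum_sum_type Xl Xr sum_subtractf sum_negf)
    have "nuH_perp \<nu> p =
        (\<Sum>j\<in>UNIV. case_sum (\<lambda>i. n (Inr i)) (\<lambda>i. - n (Inl i)) j *\<^sub>R X j p)"
      by (simp add: nuH_perp_def pbar_def qbar_def n_def sum_sum_type sum_subtractf sum_negf)
    then have "hmetric p (nuH_perp \<nu> p) (\<zeta> p) = Y \<nu> f p"
      by (simp add: \<zeta> hmetric_frame_sum_frame_sum Yf z_def[symmetric])
        (simp add: sum_sum_type sum_subtractf sum_negf mult.commute)
    then have cHS_\<zeta>: "hmetric p (cHS \<nu> p) (\<zeta> p) = omegabar \<nu> p * Y \<nu> f p"
      by (simp add: cHS_def hmetric_sym[of p _ "\<zeta> p"] linear_cmul[OF linear_hmetric])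
    have "div_HS S \<nu> \<zeta> p = 2 * real CARD('n) - 1"
      unfolding \<zeta> by (rule div_HS_centred_coordinates[OF S p W])
    then show ?thesis by (simp add: cHS_\<zeta> Tf Q)
  qed
  then show ?thesis by (auto simp: char_set_def non_characteristic_def)
qed

end
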